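(* Let $\omega\in\mathcal{X}_0$, let $\eta$ be a periodic ground state (for activity $0<\lambda<1$), and let $\Gamma$ be a finite contour in $\omega$. Then $$|\omega_\Gamma|-|\eta_\Gamma|\ \ge\ \max\Big(1,\ \frac{1}{270}\,|\Gamma|\Big).$$
   Context: $\mathbb{Z}^2$ is the square grid graph, $i\sim j$ iff $\|i-j\|_1=1$. $\mathcal{X}_0\subset\{0,1\}^{\mathbb{Z}^2}$ is the set of configurations $\omega$ such that for every $i$: $\omega_i=1$ if and only if $\omega_j=0$ for all four neighbors $j\sim i$ (equivalently, $\{i:\omega_i=1\}$ is a maximal independent set). A configuration is periodic if there are integers $v_1,v_2\ge1$ with $\omega_i=\omega_{i+(v_1,0)}=\omega_{i+(0,v_2)}$ for all $i$. For periodic $\omega\in\mathcal{X}_0$ the energy density at activity $\lambda$ is $e(\omega)=\lim_{n\to\infty}\frac{|\omega_{U_n}|}{|U_n|}(-\ln\lambda)$, where $U_n=\{-n,\dots,n\}^2$ and $|\omega_\Lambda|$ is the number of occupied sites ($i\in\Lambda$ with $\omega_i=1$). A periodic ground state is a periodic configuration in $\mathcal{X}_0$ minimizing $e$ over all periodic configurations in $\mathcal{X}_0$; for $0<\lambda<1$ these are the periodic configurations of minimal density of occupied sites. Partition $\mathbb{Z}^2$ into the $5\times5$ blocks $B(l,m)=\{-2,\dots,2\}^2+5(l,m)$, $(l,m)\in\mathbb{Z}^2$, and let $\bar\omega_{l,m}\in\{0,1\}^{5\times5}$ be the pattern of $\omega$ on $B(l,m)$. Let $\mathcal{Q}_p$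 be the set of $5\times5$ patterns arising on blocks of periodic ground states for $\lambda<1$; each such ground state corresponds to a constant block configuration $Q^{\mathbb{Z}^2}$ with $Q\in\mathcal{Q}_p$. For $Q\in\mathcal{Q}_p$, the block $B(l,m)$ is $Q$-correct in $\omega$ if $\bar\omega_{l+i,m+j}=Q$ for all $i,j\in\{0,\pm1\}$. A block is incorrect if it is not $Q$-correct for any $Q\in\mathcal{Q}_p$. A contour $\Gamma$ in $\omega$ is a (nonempty) maximal connected component of incorrect blocks, where each block is adjacent to its 8 neighboring blocks. $|\Gamma|$ is the number of blocks in $\Gamma$, and $|\omega_\Gamma|$, $|\eta_\Gamma|$ are the numbers of occupied sites of $\omega$ and $\eta$ in the union of the blocks of $\Gamma$. *)

theory Defs
  imports Complex_Main "HOL-Library.Product_Plus" "HOL-Library.FuncSet"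
begin

type_synonym site = "int \<times> int"

text \<open>Configurations: \<open>True\<close> stands for 1 (occupied), \<open>False\<close> for 0.\<close>

type_synonym config = "site \<Rightarrow> bool"

definition nbr :: "site \<Rightarrow> site \<Rightarrow> bool" where
  "nbr i j \<longleftrightarrow> \<bar>fst i - fst j\<bar> + \<bar>snd i - snd j\<bar> = 1"

definition X0 :: "config set" where
  "X0 = {\<omega>. \<forall>i. \<omega> i \<longleftrightarrow> (\<forall>j. nbr i j \<longrightarrow> \<not> \<omega> j)}"

definition periodic :: "config \<Rightarrow> bool" where
  "periodic \<omega> \<longleftrightarrow> (\<exists>v1 v2 :: int. v1 \<ge> 1 \<and> v2 \<ge> 1 \<and>
     (\<forall>i. \<omega> i = \<omega> (i + (v1, 0)) \<and> \<omega> i = \<omega> (i + (0, v2))))"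

definition occ :: "config \<Rightarrow> site set \<Rightarrow> nat" where
  "occ \<omega> \<Lambda> = card {i \<in> \<Lambda>. \<omega> i}"

definition U :: "nat \<Rightarrow> site set" where
  "U n = {- int n..int n} \<times> {- int n..int n}"

text \<open>Only used for periodic configurations, for which the limit exists.\<close>

definition energy_density :: "real \<Rightarrow> config \<Rightarrow> real" where
  "energy_density lam \<omega> = lim (\<lambda>n. real (occ \<omega> (U n)) / real (card (U n)) * (- ln lam))"

definition periodic_ground_state :: "real \<Rightarrow> config \<Rightarrow> bool" where
  "periodic_ground_state lam \<omega> \<longleftrightarrow> \<omega> \<in> X0 \<and> periodic \<omega> \<and>
     (\<forall>\<omega>'. \<omega>' \<in> X0 \<and> periodic \<omega>' \<longrightarrow> energy_density lam \<omega> \<le> energy_density lam \<omega>')"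

definition B0 :: "site set" where
  "B0 = {-2..2} \<times> {-2..2}"

text \<open>Blocks are indexed by pairs \<open>(l, m)\<close>, so block indices also have type
  \<open>int \<times> int\<close>.\<close>

type_synonym block = "int \<times> int"

definition block_shift :: "block \<Rightarrow> site" where
  "block_shift b = (5 * fst b, 5 * snd b)"

definition block_sites :: "block \<Rightarrow> site set" where
  "block_sites b = (\<lambda>i. i + block_shift b) ` B0"

text \<open>Patterns are functions on \<open>B0\<close>, made extensional by \<^const>\<open>restrict\<close> so that
  equality of patterns is agreement on \<open>B0\<close>.\<close>

definition block_pattern :: "config \<Rightarrow> block \<Rightarrow> site \<Rightarrow> bool" where
  "block_pattern \<omega> b = restrict (\<lambda>i. \<omega> (i + block_shift b)) B0"

definition Qp :: "real \<Rightarrow> (site \<Rightarrow> bool) set" where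
  "Qp lam = {block_pattern \<omega> b | \<omega> b. periodic_ground_state lam \<omega>}"

definition Q_correct :: "(site \<Rightarrow> bool) \<Rightarrow> config \<Rightarrow> block \<Rightarrow> bool" where
  "Q_correct Q \<omega> b \<longleftrightarrow> (\<forall>i\<in>{-1, 0, 1}. \<forall>j\<in>{-1, 0, 1}. block_pattern \<omega> (b + (i, j)) = Q)"

definition incorrect_blocks :: "real \<Rightarrow> config \<Rightarrow> block set" where
  "incorrect_blocks lam \<omega> = {b. \<not> (\<exists>Q\<in>Qp lam. Q_correct Q \<omega> b)}"

definition block_adj :: "block \<Rightarrow> block \<Rightarrow> bool" where
  "block_adj b c \<longleftrightarrow> b \<noteq> c \<and> \<bar>fst b - fst c\<bar> \<le> 1 \<and> \<bar>snd b - snd c\<bar> \<le> 1"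

definition connected_blocks :: "block set \<Rightarrow> bool" where
  "connected_blocks C \<longleftrightarrow>
     (\<forall>b\<in>C. \<forall>c\<in>C. (b, c) \<in> {(x, y). x \<in> C \<and> y \<in> C \<and> block_adj x y}\<^sup>*)"

definition contour :: "real \<Rightarrow> config \<Rightarrow> block set \<Rightarrow> bool" where
  "contour lam \<omega> \<Gamma> \<longleftrightarrow>
     \<Gamma> \<noteq> {} \<and> \<Gamma> \<subseteq> incorrect_blocks lam \<omega> \<and> connected_blocks \<Gamma> \<and>
     (\<forall>\<Delta>. \<Gamma> \<subseteq> \<Delta> \<and> \<Delta> \<subseteq> incorrect_blocks lam \<omega> \<and> connected_blocks \<Delta> \<longrightarrow> \<Delta> = \<Gamma>)"

definition occ_blocks :: "config \<Rightarrow> block set \<Rightarrow> nat" where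
  "occ_blocks \<omega> \<Gamma> = occ \<omega> (\<Union>b\<in>\<Gamma>. block_sites b)"

end

theory Submission imports Defs begin

text \<open>
  Let the cover of a site be the number of particles in its closed neighbourhood. In a maximal
  independent set every cover is at least 1, and summing covers counts every particle five times.
  So the density is at least \<open>1/5\<close>, with equality exactly for the perfect codes,
  where every cover is 1. This identifies the periodic ground states
  (\<open>periodic_ground_state_iff\<close>), and the excess number of particles in a contour should be
  a fifth of the total excess cover there. The theorem makes this exact and bounds the excess cover
  from below; the argument has two ingredients.

  Flux. Summing covers over the blocks of a contour counts particles five times only up to the
  particles seen or missed across the contour boundary. A block outside the contour that touches it is
  correct, so both blocks at a boundary side carry the same perfect code pattern. Such a pattern has exactly
  one particle on each row and each column of length 5, whatever the code. Hence each of the four unit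
  translations of the contour loses as many particles as it gains, and
  five times the particle number is the total cover (\<open>occ_contour_eq_cover_sum\<close>).

  Rigidity. If all covers on a \<open>15 \<times> 15\<close> window are 1, then the
  configuration there is a perfect code (\<open>exact_window_perfect_code\<close>), so that the central block is
  correct. Around a particle the five sites of the code are forced up to a choice of chirality, and from
  a small square the configuration extends in only one way (\<open>unique_continuation\<close>).
  Therefore each block of a contour has a site with cover at least 2 in its \<open>3 \<times> 3\<close>
  neighbourhood of blocks, and the block of that site is incorrect, hence lies in the same contour.

  At least a ninth of the blocks of the contour thus contain an excess cover, which bounds the particle
  excess below by \<open>|\<Gamma>| / 45\<close>. The excess is a positive integer, so it is also at least 1.
\<close>

section \<open>Cover counts\<close>

definition plus_shape :: "site set" where
  "plus_shape = {(0, 0), (1, 0), (-1, 0), (0, 1), (0, -1)}"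

definition cover :: "config \<Rightarrow> site \<Rightarrow> nat" where
  "cover \<omega> i = (\<Sum>d\<in>plus_shape. of_bool (\<omega> (i + d)))"

lemma cover_eq:
  "cover \<omega> (x, y) = of_bool (\<omega> (x, y)) + of_bool (\<omega> (x + 1, y)) + of_bool (\<omega> (x - 1, y))
     + of_bool (\<omega> (x, y + 1)) + of_bool (\<omega> (x, y - 1))"
  by (simp add: cover_def plus_shape_def)

lemma nbr_iff:
  "nbr (x, y) j \<longleftrightarrow> j = (x + 1, y) \<or> j = (x - 1, y) \<or> j = (x, y + 1) \<or> j = (x, y - 1)"
  by (cases j) (auto simp: nbr_def)

lemma X0_iff:
  "\<omega> \<in> X0 \<longleftrightarrow> (\<forall>x y. \<omega> (x, y) \<longleftrightarrow>
     \<not> \<omega> (x + 1, y) \<and> \<not> \<omega> (x - 1, y) \<and> \<not> \<omega> (x, y + 1) \<and> \<not> \<omega> (x, y - 1))"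
  by (auto simp: X0_def nbr_iff)

text \<open>
  In terms of covers, membership in \<open>X0\<close> no longer mentions individual neighbours, which makes its
  invariance under the symmetries of the lattice immediate.
\<close>

lemma X0_iff_cover:
  "\<omega> \<in> X0 \<longleftrightarrow> (\<forall>i. 1 \<le> cover \<omega> i \<and> (\<omega> i \<longrightarrow> cover \<omega> i = 1))"
proof -
  have "(\<omega> (x, y) \<longleftrightarrow>
      \<not> \<omega> (x + 1, y) \<and> \<not> \<omega> (x - 1, y) \<and> \<not> \<omega> (x, y + 1) \<and> \<not> \<omega> (x, y - 1)) \<longleftrightarrow>
      1 \<le> cover \<omega> (x, y) \<and> (\<omega> (x, y) \<longrightarrow> cover \<omega> (x, y) = 1)" for x y
    by (auto simp: cover_eq)
  then show ?thesis unfolding X0_iff by simp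
qed

text \<open>
  The propositional form is what the local case analyses feed to automation.
\<close>

lemma cover_1_iff:
  "cover \<omega> (x, y) = 1 \<longleftrightarrow>
     (\<omega> (x, y) \<or> \<omega> (x + 1, y) \<or> \<omega> (x - 1, y) \<or> \<omega> (x, y + 1) \<or> \<omega> (x, y - 1)) \<and>
     \<not> (\<omega> (x, y) \<and> \<omega> (x + 1, y)) \<and> \<not> (\<omega> (x, y) \<and> \<omega> (x - 1, y)) \<and>
     \<not> (\<omega> (x, y) \<and> \<omega> (x, y + 1)) \<and> \<not> (\<omega> (x, y) \<and> \<omega> (x, y - 1)) \<and>
     \<not> (\<omega> (x + 1, y) \<and> \<omega> (x - 1, y)) \<and> \<not> (\<omega> (x + 1, y) \<and> \<omega> (x, y + 1)) \<and>
     \<not> (\<omega> (x + 1, y) \<and> \<omega> (x, y - 1)) \<and> \<not> (\<omega> (x - 1, y) \<and> \<omega> (x, y + 1)) \<and>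
     \<not> (\<omega> (x - 1, y) \<and> \<omega> (x, y - 1)) \<and> \<not> (\<omega> (x, y + 1) \<and> \<omega> (x, y - 1))"
  unfolding cover_eq by (simp add: of_bool_def)

lemma occ_eq_sum: "finite \<Lambda> \<Longrightarrow> occ \<omega> \<Lambda> = (\<Sum>i\<in>\<Lambda>. of_bool (\<omega> i))"
  by (simp add: occ_def sum_of_bool_eq Int_def)

section \<open>The perfect codes\<close>

text \<open>
  For \<open>s = 2\<close> and \<open>s = -2\<close> these are the two chiralities of the lattice generated by a knight's move
  and its quarter turn;
  \<open>c\<close> selects one of its five translates.
\<close>

definition perfect_code :: "int \<Rightarrow> int \<Rightarrow> config" where
  "perfect_code s c = (\<lambda>(x, y). 5 dvd (x + s * y - c))"

text \<open>
  Moving to the four neighbours changes \<open>x + s * y\<close> by \<open>1\<close>, \<open>-1\<close>, \<open>s\<close> and \<open>-s\<close>;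
  together with 0 these are all residues modulo 5.
\<close>

lemma cover_perfect_code:
  assumes "s \<in> {2, -2}"
  shows "cover (perfect_code s c) i = 1"
proof -
  obtain x y where i: "i = (x, y)" by fastforce
  define t where "t = x + s * y - c"
  have "s = 2 \<or> s = -2" using assms by auto
  moreover have "x + 1 + s * y - c = t + 1" "x - 1 + s * y - c = t - 1"
      "x + s * (y + 1) - c = t + s" "x + s * (y - 1) - c = t - s"
    by (simp_all add: t_def algebra_simps)
  ultimately show ?thesis
    unfolding i cover_1_iff perfect_code_def prod.case t_def[symmetric]
    by (elim disjE; simp only:; presburger)
qed

section \<open>Densities of periodic configurations\<close>

lemma sum_periodic_window:
  fixes g :: "int \<Rightarrow> 'a :: ab_group_add"
  assumes v: "v \<ge> 1" and per: "\<And>x. g (x + v) = g x"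
  shows "sum g {a..<a + v} = sum g {0..<v}"
proof -
  have step: "sum g {b + 1..<b + 1 + v} = sum g {b..<b + v}" for b
  proof -
    have "insert b {b + 1..<b + 1 + v} = insert (b + v) {b..<b + v}" using v by auto
    then have "sum g (insert b {b + 1..<b + 1 + v}) = sum g (insert (b + v) {b..<b + v})"
      by simp
    then show ?thesis by (simp add: per)
  qed
  show ?thesis
  proof (induction a rule: int_induct[where k = 0])
    case base
    show ?case by simp
  next
    case (step1 i)
    then show ?case using step[of i] by simp
  next
    case (step2 i)
    then show ?case using step[of "i - 1"] by simp
  qed
qed

text \<open>
  Enlarging the window \<open>{-n..n}\<close> by one period on each side adds exactly two full periods, so the
  deviation from the mean is itself periodic in \<open>n\<close>. It is hence bounded by its values
  for \<open>n < v\<close>. The bound is explicit because it has to be uniform over the rows of a configuration.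
\<close>

lemma periodic_sum_deviation:
  fixes g :: "int \<Rightarrow> real"
  assumes v: "v \<ge> 1" and per: "\<And>x. g (x + v) = g x" and g: "\<And>x. 0 \<le> g x" "\<And>x. g x \<le> M"
  shows "\<bar>sum g {- int n..int n} - (2 * real n + 1) * (sum g {0..<v} / of_int v)\<bar> \<le> 2 * of_int v * M"
proof (induction n rule: less_induct)
  case (less n)
  define S where "S = sum g {0..<v}"
  show ?case
  proof (cases "int n < v")
    case True
    have M: "0 \<le> M" using g[of 0] by linarith
    have S: "0 \<le> S" "S \<le> of_int v * M"
      using sum_nonneg[of "{0..<v}" g] sum_bounded_above[of "{0..<v}" g M] v g by (auto simp: S_def)
    have G: "0 \<le> sum g {- int n..int n}" "sum g {- int n..int n} \<le> (2 * real n + 1) * M"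
      using sum_nonneg[of "{- int n..int n}" g] sum_bounded_above[of "{- int n..int n}" g M] g
      by (auto simp: algebra_simps)
    have q: "0 \<le> S / of_int v" "S / of_int v \<le> M" using S v by (auto simp: field_simps)
    have q': "0 \<le> (2 * real n + 1) * (S / of_int v)"
      by (rule mult_nonneg_nonneg[OF _ q(1)]) simp
    have q'': "(2 * real n + 1) * (S / of_int v) \<le> (2 * real n + 1) * M"
      by (rule mult_left_mono[OF q(2)]) simp
    have "2 * int n + 1 \<le> 2 * v" using True by simp
    then have "real_of_int (2 * int n + 1) \<le> real_of_int (2 * v)" by (rule of_int_le_iff[THEN iffD2])
    then have "(2 * real n + 1) * M \<le> 2 * of_int v * M" using M by (intro mult_right_mono) auto
    with G q' q'' show ?thesis unfolding S_def by linarith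
  next
    case False
    define m where "m = n - nat v"
    have n: "int n = int m + v" using False v by (simp add: m_def)
    have m: "m < n" using n v by simp
    have split: "{- int n..int n} =
        {- int n..<- int n + v} \<union> {- int m..int m} \<union> {int m + 1..<int m + 1 + v}"
      using n v by auto
    have "sum g {- int n..int n} =
        sum g {- int n..<- int n + v} + sum g {- int m..int m} + sum g {int m + 1..<int m + 1 + v}"
      unfolding split using n v by (subst sum.union_disjoint; auto)+
    moreover have "sum g {a..<a + v} = S" for a
      unfolding S_def by (rule sum_periodic_window[OF v]) (rule per)
    ultimately have e: "sum g {- int n..int n} = sum g {- int m..int m} + 2 * S"
      by (simp only:)
    have "real n = real m + of_int v" using n by linarith
    then have "(2 * real n + 1) * (S / of_int v) = (2 * real m + 1) * (S / of_int v) + 2 * S"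
      using v by (simp add: field_simps)
    with e less[OF m] show ?thesis unfolding S_def by simp
  qed
qed

text \<open>
  The one-dimensional estimate is applied to every row and then to the row averages; the error is of the
  order of the perimeter of the box.
\<close>

lemma periodic_density_tendsto:
  fixes v1 v2 :: int
  assumes v: "v1 \<ge> 1" "v2 \<ge> 1"
    and per: "\<And>x y. \<omega> (x + v1, y) = \<omega> (x, y)" "\<And>x y. \<omega> (x, y + v2) = \<omega> (x, y)"
  shows "(\<lambda>n. real (occ \<omega> (U n)) / real (card (U n))) \<longlonglongrightarrow>
     (\<Sum>x\<in>{0..<v1}. \<Sum>y\<in>{0..<v2}. of_bool (\<omega> (x, y))) / (of_int v1 * of_int v2)"
proof -
  define h :: "int \<Rightarrow> real" where "h x = (\<Sum>y\<in>{0..<v2}. of_bool (\<omega> (x, y)))" for x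
  define A where "A = sum h {0..<v1}"
  define N :: "nat \<Rightarrow> real" where "N n = 2 * real n + 1" for n
  define C :: real where "C = 2 * of_int v2 + 2 * of_int v1"
  have dev: "\<bar>real (occ \<omega> (U n)) - N n * N n * (A / (of_int v1 * of_int v2))\<bar> \<le> N n * C" for n
  proof -
    define I where "I = {- int n..int n}"
    have cI: "real (card I) = N n" by (simp add: I_def N_def)
    have o: "real (occ \<omega> (U n)) = (\<Sum>x\<in>I. \<Sum>y\<in>I. of_bool (\<omega> (x, y)))"
      by (simp add: occ_eq_sum U_def I_def sum.cartesian_product case_prod_unfold del: sum_of_bool_eq)
    have row: "\<bar>(\<Sum>y\<in>I. of_bool (\<omega> (x, y))) - N n * (h x / of_int v2)\<bar> \<le> 2 * of_int v2" for x
      using periodic_sum_deviation[of v2 "\<lambda>y. of_bool (\<omega> (x, y))" 1 n] v per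
      by (simp add: I_def N_def h_def)
    have "real (occ \<omega> (U n)) - N n * (sum h I / of_int v2) =
        (\<Sum>x\<in>I. (\<Sum>y\<in>I. of_bool (\<omega> (x, y))) - N n * (h x / of_int v2))"
      unfolding o by (simp add: sum_subtractf sum_distrib_left sum_divide_distrib)
    also have "\<bar>\<dots>\<bar> \<le> (\<Sum>x\<in>I. 2 * of_int v2)"
      by (rule order_trans[OF sum_abs sum_mono[OF row]])
    also have "\<dots> = N n * (2 * of_int v2)" using cI by simp
    finally have 1: "\<bar>real (occ \<omega> (U n)) - N n * (sum h I / of_int v2)\<bar> \<le> N n * (2 * of_int v2)" .
    have hb: "0 \<le> h x" "h x \<le> of_int v2" for x
      using sum_nonneg[of "{0..<v2}" "\<lambda>y. of_bool (\<omega> (x, y)) :: real"]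
        sum_bounded_above[of "{0..<v2}" "\<lambda>y. of_bool (\<omega> (x, y)) :: real" 1] v
      by (auto simp: h_def)
    have "\<bar>sum h I - N n * (A / of_int v1)\<bar> \<le> 2 * of_int v1 * of_int v2"
      using periodic_sum_deviation[of v1 h "of_int v2" n] v per hb
      by (simp add: I_def N_def A_def h_def)
    moreover have "N n * (sum h I / of_int v2) - N n * N n * (A / (of_int v1 * of_int v2))
        = N n / of_int v2 * (sum h I - N n * (A / of_int v1))"
      using v by (simp add: field_simps)
    moreover have Nv: "N n / of_int v2 \<ge> 0" using v by (simp add: N_def)
    ultimately have "\<bar>N n * (sum h I / of_int v2) - N n * N n * (A / (of_int v1 * of_int v2))\<bar>
        \<le> N n / of_int v2 * (2 * of_int v1 * of_int v2)"
      by (simp only: abs_mult abs_of_nonneg[OF Nv] mult_left_mono)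
    also have "\<dots> = N n * (2 * of_int v1)" using v by simp
    finally show ?thesis using 1 unfolding C_def by (simp only: distrib_left)
  qed
  have N: "N n \<ge> 1" for n by (simp add: N_def)
  have U: "real (card (U n)) = N n * N n" for n by (simp add: U_def N_def card_cartesian_product)
  have "\<bar>real (occ \<omega> (U n)) / real (card (U n)) - A / (of_int v1 * of_int v2)\<bar> \<le> C / N n" for n
  proof -
    have "real (occ \<omega> (U n)) / real (card (U n)) - A / (of_int v1 * of_int v2) =
       (real (occ \<omega> (U n)) - N n * N n * (A / (of_int v1 * of_int v2))) / (N n * N n)"
      using N[of n] unfolding U by (subst diff_divide_distrib) simp
    also have "\<bar>\<dots>\<bar> \<le> N n * C / (N n * N n)"
      unfolding abs_divide abs_of_nonneg[OF zero_le_square] by (rule divide_right_mono[OF dev]) simp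
    also have "\<dots> = C / N n" using N[of n] by simp
    finally show ?thesis .
  qed
  moreover have "(\<lambda>n. C / N n) \<longlonglongrightarrow> 0"
  proof -
    have "filterlim N at_top sequentially"
      unfolding N_def
      by (rule filterlim_at_top_mono[OF filterlim_real_sequentially]) simp
    then show ?thesis by (intro tendsto_divide_0[OF tendsto_const] filterlim_at_top_imp_at_infinity)
  qed
  ultimately have "(\<lambda>n. real (occ \<omega> (U n)) / real (card (U n)) - A / (of_int v1 * of_int v2)) \<longlonglongrightarrow> 0"
    by (elim tendsto_0_le[where K = 1])
      (auto intro!: always_eventually order_trans[OF _ abs_ge_self] simp del: abs_divide)
  then show ?thesis unfolding A_def h_def by (simp add: LIM_zero_iff)
qed

section \<open>Ground states are the everywhere exact configurations\<close>

lemma periodic_reduce: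
  fixes v :: int
  assumes "\<And>x. g (x + v) = g x"
  shows "g (x mod v) = g x"
proof -
  have nat: "g (y + int n * v) = g y" for y n
  proof (induction n)
    case (Suc n)
    have "g (y + int (Suc n) * v) = g ((y + int n * v) + v)" by (simp add: algebra_simps)
    then show ?case using assms Suc by simp
  qed simp
  have "g (y + k * v) = g y" for y k
  proof (cases "k \<ge> 0")
    case True
    then show ?thesis using nat[of y "nat k"] by simp
  next
    case False
    then show ?thesis using nat[of "y + k * v" "nat (- k)"] by simp
  qed
  from this[of "x mod v" "x div v"] show ?thesis by (simp add: mult.commute)
qed

text \<open>
  Over a full period, each of the five translates in the cover has the same sum as the configuration.
\<close>

lemma periodic_mean_eq_cover_mean:
  fixes v1 v2 :: int
  assumes v: "v1 \<ge> 1" "v2 \<ge> 1"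
    and per: "\<And>x y. \<omega> (x + v1, y) = \<omega> (x, y)" "\<And>x y. \<omega> (x, y + v2) = \<omega> (x, y)"
  shows "5 * (\<Sum>x\<in>{0..<v1}. \<Sum>y\<in>{0..<v2}. of_bool (\<omega> (x, y)) :: real) =
     (\<Sum>x\<in>{0..<v1}. \<Sum>y\<in>{0..<v2}. real (cover \<omega> (x, y)))"
proof -
  define f :: "int \<Rightarrow> int \<Rightarrow> real" where "f x y = of_bool (\<omega> (x, y))" for x y
  have shift: "(\<Sum>x\<in>{0..<v}. g (x + a)) = sum g {0..<v}"
    if "v \<ge> 1" "\<And>x. g (x + v) = g x" for g :: "int \<Rightarrow> real" and v a
  proof -
    have "(\<Sum>x\<in>{0..<v}. g (x + a)) = sum g {a..<a + v}"
      by (rule sum.reindex_bij_witness[of _ "\<lambda>x. x - a" "\<lambda>x. x + a"]) auto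
    also have "\<dots> = sum g {0..<v}" by (rule sum_periodic_window) (use that in auto)
    finally show ?thesis .
  qed
  have shifted: "(\<Sum>x\<in>{0..<v1}. \<Sum>y\<in>{0..<v2}. f (x + a) (y + b)) =
      (\<Sum>x\<in>{0..<v1}. \<Sum>y\<in>{0..<v2}. f x y)" for a b
  proof -
    have "(\<Sum>x\<in>{0..<v1}. \<Sum>y\<in>{0..<v2}. f (x + a) (y + b)) =
        (\<Sum>x\<in>{0..<v1}. \<Sum>y\<in>{0..<v2}. f (x + a) y)"
      by (intro sum.cong refl shift[OF v(2)]) (simp add: f_def per)
    also have "\<dots> = (\<Sum>x\<in>{0..<v1}. \<Sum>y\<in>{0..<v2}. f x y)"
      by (rule shift[OF v(1)]) (simp add: f_def per)
    finally show ?thesis .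
  qed
  have "real (cover \<omega> (x, y)) = f x y + f (x + 1) y + f (x + - 1) y + f x (y + 1) + f x (y + - 1)"
    for x y
    by (simp add: cover_eq f_def)
  then have "(\<Sum>x\<in>{0..<v1}. \<Sum>y\<in>{0..<v2}. real (cover \<omega> (x, y))) =
      5 * (\<Sum>x\<in>{0..<v1}. \<Sum>y\<in>{0..<v2}. f x y)"
    using shifted[of 1 0] shifted[of "-1" 0] shifted[of 0 1] shifted[of 0 "-1"]
    by (simp add: sum.distrib)
  then show ?thesis by (simp add: f_def)
qed

text \<open>
  The density is a fifth of the mean cover, and covers are at least 1.
\<close>

lemma energy_density_periodic:
  assumes \<omega>: "\<omega> \<in> X0" "periodic \<omega>"
  obtains \<delta> where "energy_density lam \<omega> = \<delta> * (- ln lam)" "\<delta> \<ge> 1 / 5"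
    "\<delta> = 1 / 5 \<longleftrightarrow> (\<forall>i. cover \<omega> i = 1)"
proof -
  obtain v1 v2 where v: "v1 \<ge> 1" "v2 \<ge> 1"
    and per': "\<And>i. \<omega> i = \<omega> (i + (v1, 0))" "\<And>i. \<omega> i = \<omega> (i + (0, v2))"
    using \<omega>(2) unfolding periodic_def by blast
  have per: "\<omega> (x + v1, y) = \<omega> (x, y)" "\<omega> (x, y + v2) = \<omega> (x, y)" for x y
    using per'[of "(x, y)"] by simp_all
  define S :: real where "S = (\<Sum>x\<in>{0..<v1}. \<Sum>y\<in>{0..<v2}. of_bool (\<omega> (x, y)))"
  define E :: real where
    "E = (\<Sum>i\<in>{0..<v1} \<times> {0..<v2}. real (cover \<omega> i) - 1)"
  define \<delta> where "\<delta> = S / (of_int v1 * of_int v2)"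
  have "(\<lambda>n. real (occ \<omega> (U n)) / real (card (U n)) * (- ln lam)) \<longlonglongrightarrow> \<delta> * (- ln lam)"
    unfolding \<delta>_def S_def by (intro tendsto_mult periodic_density_tendsto v per tendsto_const)
  then have "energy_density lam \<omega> = \<delta> * (- ln lam)"
    unfolding energy_density_def by (rule limI)
  moreover have S: "5 * S = of_int v1 * of_int v2 + E"
    using periodic_mean_eq_cover_mean[of v1 v2 \<omega>] v per
    by (simp add: S_def E_def sum.cartesian_product sum_subtractf)
  have pos: "0 \<le> real (cover \<omega> i) - 1" for i using \<omega>(1)[unfolded X0_iff_cover, rule_format, of i] by simp
  then have "0 \<le> E" unfolding E_def by (simp add: sum_nonneg)
  then have "\<delta> \<ge> 1 / 5" using S v by (simp add: \<delta>_def field_simps)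
  moreover have "\<delta> = 1 / 5 \<longleftrightarrow> (\<forall>i. cover \<omega> i = 1)"
  proof -
    have "\<delta> = 1 / 5 \<longleftrightarrow> 5 * S = of_int v1 * of_int v2"
      using v by (auto simp: \<delta>_def field_simps)
    also have "\<dots> \<longleftrightarrow> E = 0" using S by simp
    also have "\<dots> \<longleftrightarrow> (\<forall>i\<in>{0..<v1} \<times> {0..<v2}. real (cover \<omega> i) - 1 = 0)"
      unfolding E_def by (rule sum_nonneg_eq_0_iff) (use pos in auto)
    also have "\<dots> \<longleftrightarrow> (\<forall>i. cover \<omega> i = 1)"
    proof
      assume *: "\<forall>i\<in>{0..<v1} \<times> {0..<v2}. real (cover \<omega> i) - 1 = 0"
      have "cover \<omega> (x, y) = 1" for x y
      proof -
        have "\<omega> (x' + v1 + 1, y') = \<omega> (x' + 1, y')" "\<omega> (x' + v1 - 1, y') = \<omega> (x' - 1, y')"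
          "\<omega> (x', y' + v2 + 1) = \<omega> (x', y' + 1)" "\<omega> (x', y' + v2 - 1) = \<omega> (x', y' - 1)" for x' y'
          using per(1)[of "x' + 1" y'] per(1)[of "x' - 1" y'] per(2)[of x' "y' + 1"] per(2)[of x' "y' - 1"]
          by (simp_all add: algebra_simps)
        then have "cover \<omega> (x' + v1, y') = cover \<omega> (x', y')" "cover \<omega> (x', y' + v2) = cover \<omega> (x', y')"
          for x' y'
          by (simp_all only: cover_eq per)
        then have "cover \<omega> (x, y) = cover \<omega> (x mod v1, y mod v2)"
          using periodic_reduce[of "\<lambda>x. cover \<omega> (x, y mod v2)" v1 x]
            periodic_reduce[of "\<lambda>y. cover \<omega> (x, y)" v2 y] by simp
        moreover have "(x mod v1, y mod v2) \<in> {0..<v1} \<times> {0..<v2}" using v by simp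
        ultimately show ?thesis using * by force
      qed
      then show "\<forall>i. cover \<omega> i = 1" by auto
    qed auto
    finally show ?thesis .
  qed
  ultimately show thesis by (rule that)
qed

lemma perfect_code_periodic: "periodic (perfect_code s c)"
  unfolding periodic_def
proof (intro exI[of _ 5] conjI allI)
  fix i :: site
  obtain x y where i: "i = (x, y)" by fastforce
  have "x + 5 + s * y - c = (x + s * y - c) + 5" "x + s * (y + 5) - c = (x + s * y - c) + 5 * s"
    by (simp_all add: algebra_simps)
  then show "perfect_code s c i = perfect_code s c (i + (5, 0))"
    "perfect_code s c i = perfect_code s c (i + (0, 5))"
    unfolding i perfect_code_def add_Pair add_0_right prod.case by presburger+
qed simp_all

lemma periodic_ground_state_iff:
  assumes lam: "0 < lam" "lam < 1"
  shows "periodic_ground_state lam \<omega> \<longleftrightarrow> periodic \<omega> \<and> (\<forall>i. cover \<omega> i = 1)"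
proof
  have ln: "- ln lam > 0" using lam by simp
  assume gs: "periodic_ground_state lam \<omega>"
  then have \<omega>: "\<omega> \<in> X0" "periodic \<omega>" by (auto simp: periodic_ground_state_def)
  define \<pi> where "\<pi> = perfect_code 2 0"
  have \<pi>: "\<And>i. cover \<pi> i = 1" "periodic \<pi>"
    by (simp_all add: \<pi>_def cover_perfect_code perfect_code_periodic)
  then have "\<pi> \<in> X0" by (simp add: X0_iff_cover)
  obtain \<delta> where \<delta>: "energy_density lam \<omega> = \<delta> * (- ln lam)" "\<delta> \<ge> 1 / 5"
    "\<delta> = 1 / 5 \<longleftrightarrow> (\<forall>i. cover \<omega> i = 1)"
    using energy_density_periodic[OF \<omega>] .
  have "energy_density lam \<pi> = 1 / 5 * (- ln lam)"
    by (rule energy_density_periodic[OF \<open>\<pi> \<in> X0\<close> \<pi>(2), of lam]) (use \<pi>(1) in auto)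
  moreover have "energy_density lam \<omega> \<le> energy_density lam \<pi>"
    using gs \<pi>(2) \<open>\<pi> \<in> X0\<close> by (simp add: periodic_ground_state_def)
  ultimately have "\<delta> * (- ln lam) \<le> 1 / 5 * (- ln lam)" using \<delta>(1) by simp
  then have "\<delta> \<le> 1 / 5" using ln by (simp only: mult_le_cancel_right_pos)
  then show "periodic \<omega> \<and> (\<forall>i. cover \<omega> i = 1)" using \<delta> \<omega> by simp
next
  have ln: "- ln lam > 0" using lam by simp
  assume \<omega>: "periodic \<omega> \<and> (\<forall>i. cover \<omega> i = 1)"
  then have X0: "\<omega> \<in> X0" by (simp add: X0_iff_cover)
  have "energy_density lam \<omega> \<le> energy_density lam \<omega>'" if \<omega>': "\<omega>' \<in> X0" "periodic \<omega>'" for \<omega>'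
  proof -
    obtain \<delta> where \<delta>: "energy_density lam \<omega>' = \<delta> * (- ln lam)" "\<delta> \<ge> 1 / 5"
      by (rule energy_density_periodic[OF \<omega>'])
    have "energy_density lam \<omega> = 1 / 5 * (- ln lam)"
      by (rule energy_density_periodic[OF X0, of lam]) (use \<omega> in auto)
    also have "\<dots> \<le> \<delta> * (- ln lam)" using \<delta>(2) ln by (intro mult_right_mono) auto
    finally show ?thesis using \<delta>(1) by simp
  qed
  then show "periodic_ground_state lam \<omega>"
    using X0 \<omega> by (auto simp: periodic_ground_state_def)
qed

section \<open>Unique continuation of exact configurations\<close>

definition exact_on :: "config \<Rightarrow> site set \<Rightarrow> bool" where
  "exact_on \<omega> R \<longleftrightarrow> \<omega> \<in> X0 \<and> (\<forall>i\<in>R. cover \<omega> i = 1)"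

definition agree_on :: "config \<Rightarrow> config \<Rightarrow> site set \<Rightarrow> bool" where
  "agree_on \<omega> \<rho> R \<longleftrightarrow> (\<forall>i\<in>R. \<omega> i = \<rho> i)"

text \<open>
  The point symmetries of the square lattice. They reduce the four directions of continuation to one, and
  the two corners of a column to one.
\<close>

definition symmetry :: "(site \<Rightarrow> site) \<Rightarrow> bool" where
  "symmetry T \<longleftrightarrow> (\<exists>s\<in>{1, -1}. \<exists>t\<in>{1, -1}.
     T = (\<lambda>(x, y). (s * x, t * y)) \<or> T = (\<lambda>(x, y). (s * y, t * x)))"

lemma symmetry_cases:
  assumes "symmetry T"
  obtains "T = (\<lambda>(x, y). (x, y))" | "T = (\<lambda>(x, y). (- x, y))" | "T = (\<lambda>(x, y). (x, - y))"
    | "T = (\<lambda>(x, y). (- x, - y))" | "T = (\<lambda>(x, y). (y, x))" | "T = (\<lambda>(x, y). (- y, x))"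
    | "T = (\<lambda>(x, y). (y, - x))" | "T = (\<lambda>(x, y). (- y, - x))"
  using assms unfolding symmetry_def by auto

lemma cover_symmetry:
  assumes "symmetry T"
  shows "cover (\<omega> \<circ> T) i = cover \<omega> (T i)"
  using assms
  by (cases i; cases rule: symmetry_cases) (simp_all add: cover_eq algebra_simps)

lemma X0_symmetry:
  assumes "symmetry T" "\<omega> \<in> X0"
  shows "\<omega> \<circ> T \<in> X0"
  using assms(2) unfolding X0_iff_cover cover_symmetry[OF assms(1)] comp_apply by blast

lemma exact_on_symmetry:
  assumes "symmetry T" "exact_on \<omega> (T ` R)"
  shows "exact_on (\<omega> \<circ> T) R"
  using assms by (simp add: exact_on_def cover_symmetry X0_symmetry)

text \<open>
  This is the delicate point of unique continuation. The site \<open>(x, y)\<close> is the lower right corner of the known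
  rectangle, so its cover involves two unknown sites, \<open>(x + 1, y)\<close> and \<open>(x, y - 1)\<close>. Suppose
  that \<open>\<omega>\<close> covers the corner from the first one and \<open>\<rho>\<close> does not. Then \<open>\<rho>\<close> covers it from the
  second one, and it must cover \<open>(x + 1, y + 1)\<close> from \<open>(x + 2, y + 1)\<close>, the only site left unknown
  there. These two particles, and the agreement with \<open>\<omega>\<close> at the known neighbours, leave no
  way of covering \<open>(x + 1, y)\<close> in \<open>\<rho>\<close>.
\<close>

lemma corner_continuation:
  assumes X0: "\<omega> \<in> X0" "\<rho> \<in> X0"
    and \<omega>: "cover \<omega> (x, y) = 1" "cover \<omega> (x + 1, y) = 1" "cover \<omega> (x + 1, y + 1) = 1"
    and \<rho>: "cover \<rho> (x, y) = 1" "cover \<rho> (x + 1, y) = 1" "cover \<rho> (x + 1, y + 1) = 1"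
    and eq: "\<omega> (x - 1, y) = \<rho> (x - 1, y)" "\<omega> (x, y) = \<rho> (x, y)" "\<omega> (x, y + 1) = \<rho> (x, y + 1)"
      "\<omega> (x + 1, y + 1) = \<rho> (x + 1, y + 1)" "\<omega> (x + 1, y + 2) = \<rho> (x + 1, y + 2)"
    and "\<omega> (x + 1, y)"
  shows "\<rho> (x + 1, y)"
proof (rule ccontr)
  assume n: "\<not> \<rho> (x + 1, y)"
  have \<rho>X: "\<not> (\<rho> (i, j) \<and> \<rho> (i + 1, j))" "\<not> (\<rho> (i, j) \<and> \<rho> (i, j + 1))" for i j
    using X0(2) unfolding X0_iff by metis+
  note w = \<omega>[unfolded cover_1_iff, simplified]
  note r = \<rho>[unfolded cover_1_iff, simplified]
  have "\<rho> (x, y - 1)" using r(1) w(1) eq n \<open>\<omega> (x + 1, y)\<close> by blast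
  moreover have "\<rho> (x + 2, y + 1)"
    using r(3) w(3) eq n \<open>\<omega> (x + 1, y)\<close> by (auto simp: algebra_simps)
  ultimately have "\<not> \<rho> (x + 1, y - 1)" "\<not> \<rho> (x + 2, y)"
    using \<rho>X(1)[of x "y - 1"] \<rho>X(2)[of "x + 2" y] by auto
  moreover have "\<not> \<rho> (x, y)" "\<not> \<rho> (x + 1, y + 1)"
    using w(2) eq \<open>\<omega> (x + 1, y)\<close> by (auto simp: algebra_simps)
  ultimately show False using r(2) n by (auto simp: algebra_simps)
qed

lemma corner_continuation_eq:
  assumes "\<omega> \<in> X0" "\<rho> \<in> X0"
    and "cover \<omega> (x, y) = 1" "cover \<omega> (x + 1, y) = 1" "cover \<omega> (x + 1, y + 1) = 1"
    and "cover \<rho> (x, y) = 1" "cover \<rho> (x + 1, y) = 1" "cover \<rho> (x + 1, y + 1) = 1"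
    and "\<omega> (x - 1, y) = \<rho> (x - 1, y)" "\<omega> (x, y) = \<rho> (x, y)" "\<omega> (x, y + 1) = \<rho> (x, y + 1)"
      "\<omega> (x + 1, y + 1) = \<rho> (x + 1, y + 1)" "\<omega> (x + 1, y + 2) = \<rho> (x + 1, y + 2)"
  shows "\<omega> (x + 1, y) = \<rho> (x + 1, y)"
  using corner_continuation[of \<omega> \<rho> x y] corner_continuation[of \<rho> \<omega> x y] assms by argo

text \<open>
  Away from the corners, the cover of a site of the last known column involves a single unknown site,
  which is therefore determined. The corner argument uses two further sites of the new column, and both
  corners need them to be interior, so the height of the rectangle must be at least 4.
\<close>

lemma continuation_step:
  assumes ex: "exact_on \<omega> ({a..b + 1} \<times> {c..d})" "exact_on \<rho> ({a..b + 1} \<times> {c..d})"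
    and agree: "agree_on \<omega> \<rho> ({a..b} \<times> {c..d})"
    and size: "a < b" "c + 3 \<le> d"
  shows "agree_on \<omega> \<rho> ({a..b + 1} \<times> {c..d})"
proof -
  have X0: "\<omega> \<in> X0" "\<rho> \<in> X0" using ex by (auto simp: exact_on_def)
  have cov: "cover \<omega> (x, y) = 1" "cover \<rho> (x, y) = 1" if "a \<le> x" "x \<le> b + 1" "c \<le> y" "y \<le> d" for x y
    using ex that by (auto simp: exact_on_def)
  have eq: "\<omega> (x, y) = \<rho> (x, y)" if "a \<le> x" "x \<le> b" "c \<le> y" "y \<le> d" for x y
    using agree that by (auto simp: agree_on_def)
  have inner: "\<omega> (b + 1, y) = \<rho> (b + 1, y)" if "c < y" "y < d" for y
    using cov[of b y, unfolded cover_1_iff] eq[of b y] eq[of "b - 1" y] eq[of b "y - 1"] eq[of b "y + 1"]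
      that size by auto
  have low: "\<omega> (b + 1, c) = \<rho> (b + 1, c)"
    by (rule corner_continuation_eq[OF X0]) (use size in \<open>simp_all add: cov eq inner\<close>)
  define T :: "site \<Rightarrow> site" where "T = (\<lambda>(x, y). (x, - y))"
  have T: "symmetry T" unfolding symmetry_def T_def by force
  have T_apply: "(\<sigma> \<circ> T) (x, y) = \<sigma> (x, - y)" for \<sigma> :: config and x y by (simp add: T_def)
  have cover_T: "cover (\<sigma> \<circ> T) (x, y) = cover \<sigma> (x, - y)" for \<sigma> x y
    unfolding cover_symmetry[OF T] by (simp add: T_def)
  have "(\<omega> \<circ> T) (b + 1, - d) = (\<rho> \<circ> T) (b + 1, - d)"
    by (rule corner_continuation_eq[OF X0_symmetry[OF T X0(1)] X0_symmetry[OF T X0(2)]])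
      (use size in \<open>simp_all add: cover_T T_apply cov eq inner del: comp_apply\<close>)
  then have high: "\<omega> (b + 1, d) = \<rho> (b + 1, d)" by (simp add: T_apply del: comp_apply)
  show ?thesis unfolding agree_on_def
  proof (clarify)
    fix x y
    assume "x \<in> {a..b + 1}" "y \<in> {c..d}"
    then show "\<omega> (x, y) = \<rho> (x, y)"
      using eq[of x y] inner[of y] low high by (cases "x = b + 1"; cases "y = c"; cases "y = d") auto
  qed
qed

lemma continuation_right:
  assumes "b \<le> b'"
    and "exact_on \<omega> ({a..b'} \<times> {c..d})" "exact_on \<rho> ({a..b'} \<times> {c..d})"
    and "agree_on \<omega> \<rho> ({a..b} \<times> {c..d})"
    and "a < b" "c + 3 \<le> d"
  shows "agree_on \<omega> \<rho> ({a..b'} \<times> {c..d})"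
  using assms
proof (induction b' rule: int_ge_induct)
  case (step i)
  have "exact_on \<omega> ({a..i} \<times> {c..d})" "exact_on \<rho> ({a..i} \<times> {c..d})"
    using step.prems by (auto simp: exact_on_def)
  then show ?case using step continuation_step[of \<omega> a i c d \<rho>] by simp
qed

lemma continuation_symmetry:
  assumes T: "symmetry T" and R: "T ` ({a..b'} \<times> {c..d}) = R'" "T ` ({a..b} \<times> {c..d}) = R"
    and "b \<le> b'" "a < b" "c + 3 \<le> d"
    and ex: "exact_on \<omega> R'" "exact_on \<rho> R'" and agree: "agree_on \<omega> \<rho> R"
  shows "agree_on \<omega> \<rho> R'"
proof -
  have "agree_on (\<omega> \<circ> T) (\<rho> \<circ> T) ({a..b'} \<times> {c..d})"
    using continuation_right[of b b' "\<omega> \<circ> T" a c d "\<rho> \<circ> T"] assms exact_on_symmetry[OF T]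
    by (force simp: agree_on_def)
  then show ?thesis using R by (force simp: agree_on_def)
qed

lemma image_symmetry_rectangle:
  fixes a b c d :: int
  shows "(\<lambda>(x, y). (- x, y)) ` ({a..b} \<times> {c..d}) = {- b..- a} \<times> {c..d}"
    "(\<lambda>(x, y). (y, x)) ` ({a..b} \<times> {c..d}) = {c..d} \<times> {a..b}"
    "(\<lambda>(x, y). (y, - x)) ` ({a..b} \<times> {c..d}) = {c..d} \<times> {- b..- a}"
proof -
  show "(\<lambda>(x, y). (- x, y)) ` ({a..b} \<times> {c..d}) = {- b..- a} \<times> {c..d}" (is "?L = ?R")
  proof
    show "?R \<subseteq> ?L"
    proof
      fix p assume "p \<in> ?R"
      then show "p \<in> ?L" by (intro image_eqI[of _ _ "(- fst p, snd p)"]) auto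
    qed
  qed auto
  show "(\<lambda>(x, y). (y, x)) ` ({a..b} \<times> {c..d}) = {c..d} \<times> {a..b}" by auto
  show "(\<lambda>(x, y). (y, - x)) ` ({a..b} \<times> {c..d}) = {c..d} \<times> {- b..- a}" (is "?L = ?R")
  proof
    show "?R \<subseteq> ?L"
    proof
      fix p assume "p \<in> ?R"
      then show "p \<in> ?L" by (intro image_eqI[of _ _ "(- snd p, fst p)"]) auto
    qed
  qed auto
qed

text \<open>
  The known rectangle is enlarged to the right, to the left, upwards and downwards, in this order.
\<close>

lemma unique_continuation:
  assumes ex: "exact_on \<omega> ({a'..b'} \<times> {c'..d'})" "exact_on \<rho> ({a'..b'} \<times> {c'..d'})"
    and agree: "agree_on \<omega> \<rho> ({a..b} \<times> {c..d})"
    and inside: "a' \<le> a" "b \<le> b'" "c' \<le> c" "d \<le> d'"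
    and size: "a + 3 \<le> b" "c + 3 \<le> d"
  shows "agree_on \<omega> \<rho> ({a'..b'} \<times> {c'..d'})"
proof -
  have sub: "exact_on \<omega> ({p..q} \<times> {r..t})" "exact_on \<rho> ({p..q} \<times> {r..t})"
    if "a' \<le> p" "q \<le> b'" "c' \<le> r" "t \<le> d'" for p q r t
    using ex that by (auto simp: exact_on_def)
  have sym: "symmetry (\<lambda>(x, y). (- x, y))" "symmetry (\<lambda>(x, y). (y, x))" "symmetry (\<lambda>(x, y). (y, - x))"
    unfolding symmetry_def by force+
  have "agree_on \<omega> \<rho> ({a..b'} \<times> {c..d})"
    by (rule continuation_right[OF inside(2)]) (use sub agree inside size in auto)
  then have "agree_on \<omega> \<rho> ({a'..b'} \<times> {c..d})"
    by (rule continuation_symmetry[OF sym(1), where a = "- b'" and b = "- a" and b' = "- a'" and c = c and d = d, rotated -1])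
      (use sub inside size in \<open>auto simp: image_symmetry_rectangle\<close>)
  then have "agree_on \<omega> \<rho> ({a'..b'} \<times> {c..d'})"
    by (rule continuation_symmetry[OF sym(2), where a = c and b = d and b' = d' and c = a' and d = b', rotated -1])
      (use sub inside size in \<open>auto simp: image_symmetry_rectangle\<close>)
  then show ?thesis
    by (rule continuation_symmetry[OF sym(3), where a = "- d'" and b = "- c" and b' = "- c'" and c = a' and d = b', rotated -1])
      (use sub inside size in \<open>auto simp: image_symmetry_rectangle\<close>)
qed

section \<open>Exact windows carry a perfect code\<close>

text \<open>
  The four sites diagonal to a particle must be covered from a knight's move away, with two candidates
  each. Of two candidates next to the same axis site at distance 2 only one can be occupied. These
  exclusions link the four choices in a cycle, so a single choice of chirality fixes the others.
\<close>

lemma perfect_code_around_particle: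
  assumes X0: "\<omega> \<in> X0" and ex: "\<And>i j. \<bar>i\<bar> + \<bar>j\<bar> \<le> 2 \<Longrightarrow> cover \<omega> (x + i, y + j) = 1"
    and p: "\<omega> (x, y)"
  shows "\<exists>s\<in>{2, -2}. agree_on \<omega> (perfect_code s (x + s * y)) ({x - 2..x + 2} \<times> {y - 2..y + 2})"
proof -
  define W where "W i j = \<omega> (x + i, y + j)" for i j
  have c: "(W i j \<or> W (i + 1) j \<or> W (i - 1) j \<or> W i (j + 1) \<or> W i (j - 1)) \<and>
     \<not> (W i j \<and> W (i + 1) j) \<and> \<not> (W i j \<and> W (i - 1) j) \<and>
     \<not> (W i j \<and> W i (j + 1)) \<and> \<not> (W i j \<and> W i (j - 1)) \<and>
     \<not> (W (i + 1) j \<and> W (i - 1) j) \<and> \<not> (W (i + 1) j \<and> W i (j + 1)) \<and>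
     \<not> (W (i + 1) j \<and> W i (j - 1)) \<and> \<not> (W (i - 1) j \<and> W i (j + 1)) \<and>
     \<not> (W (i - 1) j \<and> W i (j - 1)) \<and> \<not> (W i (j + 1) \<and> W i (j - 1))"
    if "\<bar>i\<bar> + \<bar>j\<bar> \<le> 2" for i j
  proof -
    have e: "x + (i + 1) = x + i + 1" "x + (i - 1) = x + i - 1" "y + (j + 1) = y + j + 1" "y + (j - 1) = y + j - 1"
      by simp_all
    show ?thesis using ex[OF that] unfolding W_def e cover_1_iff .
  qed
  have h: "\<not> (W i j \<and> W (i + 1) j)" for i j
    using X0 unfolding X0_iff W_def by (metis add.assoc)
  have p0: "W 0 0" using p by (simp add: W_def)
  have near: "\<not> W 1 0" "\<not> W (-1) 0" "\<not> W 0 1" "\<not> W 0 (-1)"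
      "\<not> W 2 0" "\<not> W (-2) 0" "\<not> W 0 2" "\<not> W 0 (-2)"
      "\<not> W 1 1" "\<not> W (-1) 1" "\<not> W 1 (-1)" "\<not> W (-1) (-1)"
    using c[of 0 0] c[of 1 0] c[of "-1" 0] c[of 0 1] c[of 0 "-1"] p0 by simp_all
  have either: "W 2 1 \<or> W 1 2" "W (-2) 1 \<or> W (-1) 2" "W 2 (-1) \<or> W 1 (-2)" "W (-2) (-1) \<or> W (-1) (-2)"
    using c[of 1 1] c[of "-1" 1] c[of 1 "-1"] c[of "-1" "-1"] near by simp_all
  have "\<not> (W 2 1 \<and> W 1 2)" using c[of 1 1] by simp
  moreover have "\<not> (W (-2) 1 \<and> W (-1) 2)" using c[of "-1" 1] by simp
  moreover have "\<not> (W 2 (-1) \<and> W 1 (-2))" using c[of 1 "-1"] by simp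
  moreover have "\<not> (W (-2) (-1) \<and> W (-1) (-2))" using c[of "-1" "-1"] by simp
  moreover have "\<not> (W 2 1 \<and> W 2 (-1))" using c[of 2 0] by simp
  moreover have "\<not> (W (-2) 1 \<and> W (-2) (-1))" using c[of "-2" 0] by simp
  moreover have "\<not> (W 1 2 \<and> W (-1) 2)" using c[of 0 2] by simp
  moreover have "\<not> (W 1 (-2) \<and> W (-1) (-2))" using c[of 0 "-2"] by simp
  ultimately have knights:
      "W 2 1 \<longleftrightarrow> \<not> W 1 2" "W (-1) 2 \<longleftrightarrow> \<not> W 1 2" "W (-2) 1 \<longleftrightarrow> W 1 2" "W (-2) (-1) \<longleftrightarrow> \<not> W 1 2"
      "W (-1) (-2) \<longleftrightarrow> W 1 2" "W 1 (-2) \<longleftrightarrow> \<not> W 1 2" "W 2 (-1) \<longleftrightarrow> W 1 2"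
    using either by argo+
  have v: "\<not> (W i j \<and> W i (j + 1))" for i j
    using X0 unfolding X0_iff W_def by (metis add.assoc)
  \<comment> \<open>The covers of the corners of the square are not assumed to be 1. But each corner is next to two
    knight positions, one of each chirality, and so next to a particle.\<close>
  have corners: "\<not> W 2 2" "\<not> W (-2) 2" "\<not> W 2 (-2)" "\<not> W (-2) (-2)"
    using h[of 1 2] v[of 2 1] h[of "-2" 2] v[of "-2" 1] h[of 1 "-2"] v[of 2 "-2"] h[of "-2" "-2"] v[of "-2" "-2"]
    by (simp_all add: knights) argo+
  have five: "i \<in> {-2, -1, 0, 1, 2}" if "-2 \<le> i" "i \<le> 2" for i :: int using that by auto
  show ?thesis
  proof (cases "W 1 2")
    case False
    then have "W i j \<longleftrightarrow> 5 dvd (i + - 2 * j)" if "i \<in> {-2, -1, 0, 1, 2}" "j \<in> {-2, -1, 0, 1, 2}" for i j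
      using that near knights corners p0 by (elim insertE emptyE; simp)
    note * = this
    have "\<omega> (u, v) = perfect_code (-2) (x + - 2 * y) (u, v)"
      if "x - 2 \<le> u" "u \<le> x + 2" "y - 2 \<le> v" "v \<le> y + 2" for u v
      using *[OF five five, of "u - x" "v - y"] that by (simp add: W_def perfect_code_def algebra_simps)
    then show ?thesis by (intro bexI[of _ "-2"]) (auto simp: agree_on_def)
  next
    case True
    then have "W i j \<longleftrightarrow> 5 dvd (i + 2 * j)" if "i \<in> {-2, -1, 0, 1, 2}" "j \<in> {-2, -1, 0, 1, 2}" for i j
      using that near knights corners p0 by (elim insertE emptyE; simp)
    note * = this
    have "\<omega> (u, v) = perfect_code 2 (x + 2 * y) (u, v)"
      if "x - 2 \<le> u" "u \<le> x + 2" "y - 2 \<le> v" "v \<le> y + 2" for u v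
      using *[OF five five, of "u - x" "v - y"] that by (simp add: W_def perfect_code_def algebra_simps)
    then show ?thesis by (intro bexI[of _ 2]) (auto simp: agree_on_def)
  qed
qed

lemma exact_perfect_code:
  assumes "s \<in> {2, -2}"
  shows "exact_on (perfect_code s c) R"
  using cover_perfect_code[OF assms] by (simp add: exact_on_def X0_iff_cover)

text \<open>
  The centre of the window is covered by a particle at distance at most 1. The perfect code around this
  particle and the configuration agree on a \<open>5 \<times> 5\<close> square, and hence on the whole window by unique
  continuation. The radius 3 makes room for all sites at distance at most 2 from the particle.
\<close>

lemma exact_window_perfect_code:
  assumes ex: "exact_on \<omega> ({x - r..x + r} \<times> {y - r..y + r})" and r: "r \<ge> 3"
  shows "\<exists>s\<in>{2, -2}. \<exists>c. agree_on \<omega> (perfect_code s c) ({x - r..x + r} \<times> {y - r..y + r})"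
proof -
  have cov: "cover \<omega> (u, v) = 1" if "\<bar>u - x\<bar> \<le> r" "\<bar>v - y\<bar> \<le> r" for u v
  proof -
    have "(u, v) \<in> {x - r..x + r} \<times> {y - r..y + r}" using that by auto
    then show ?thesis using ex unfolding exact_on_def by blast
  qed
  have X0: "\<omega> \<in> X0" using ex by (simp add: exact_on_def)
  obtain p q where pq: "\<omega> (p, q)" "\<bar>p - x\<bar> \<le> 1" "\<bar>q - y\<bar> \<le> 1" "\<bar>p - x\<bar> + \<bar>q - y\<bar> \<le> 1"
  proof -
    have "cover \<omega> (x, y) = 1" using cov[of x y] r by simp
    then consider "\<omega> (x, y)" | "\<omega> (x + 1, y)" | "\<omega> (x - 1, y)" | "\<omega> (x, y + 1)" | "\<omega> (x, y - 1)"
      unfolding cover_1_iff by blast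
    then show thesis
      by cases (use that[of x y] that[of "x + 1" y] that[of "x - 1" y] that[of x "y + 1"] that[of x "y - 1"]
        in simp_all)
  qed
  have "\<exists>s\<in>{2, -2}. agree_on \<omega> (perfect_code s (p + s * q)) ({p - 2..p + 2} \<times> {q - 2..q + 2})"
    by (rule perfect_code_around_particle[OF X0 _ pq(1)], rule cov) (use pq r in linarith)+
  then obtain s where s: "s \<in> {2, -2}"
    and agree: "agree_on \<omega> (perfect_code s (p + s * q)) ({p - 2..p + 2} \<times> {q - 2..q + 2})" by blast
  have "agree_on \<omega> (perfect_code s (p + s * q)) ({x - r..x + r} \<times> {y - r..y + r})"
    by (rule unique_continuation[OF ex exact_perfect_code[OF s] agree]) (use pq r in linarith)+
  with s show ?thesis by blast
qed

section \<open>Correct blocks\<close>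

text \<open>
  The union of the \<open>3 \<times> 3\<close> blocks around \<open>b\<close>.
\<close>

definition window :: "block \<Rightarrow> site set" where
  "window b = {5 * fst b - 7..5 * fst b + 7} \<times> {5 * snd b - 7..5 * snd b + 7}"

lemma mem_block_sites_iff: "i \<in> block_sites b \<longleftrightarrow> i - block_shift b \<in> B0"
  unfolding block_sites_def by (auto intro: image_eqI[of _ _ "i - block_shift b"])

lemma block_sites_eq:
  "block_sites (l, m) = {5 * l - 2..5 * l + 2} \<times> {5 * m - 2..5 * m + 2}"
  by (rule set_eqI, rename_tac i, case_tac i) (auto simp: mem_block_sites_iff B0_def block_shift_def)

lemma block_pattern_eq_iff:
  "block_pattern \<omega> b = restrict \<rho> B0 \<longleftrightarrow> (\<forall>i\<in>B0. \<omega> (i + block_shift b) = \<rho> i)"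
  unfolding block_pattern_def restrict_def fun_eq_iff by (auto split: if_splits)

lemma perfect_code_block_shift:
  "perfect_code s c (i + block_shift b) = perfect_code s c i"
proof -
  obtain x y l m where i: "i = (x, y)" and b: "b = (l, m)" by (cases i, cases b)
  have "x + 5 * l + s * (y + 5 * m) - c = (x + s * y - c) + 5 * (l + s * m)"
    by (simp add: algebra_simps)
  then have "5 dvd x + 5 * l + s * (y + 5 * m) - c \<longleftrightarrow> 5 dvd x + s * y - c" by presburger
  then show ?thesis by (simp add: i b perfect_code_def block_shift_def)
qed

lemma site_in_block_of_window:
  assumes "i \<in> window b"
  obtains p q where "p \<in> {-1, 0, 1}" "q \<in> {-1, 0, 1}" "i \<in> block_sites (b + (p, q))"
proof -
  obtain x y l m where i: "i = (x, y)" and b: "b = (l, m)" by (cases i, cases b)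
  have *: "\<exists>p\<in>{-1, 0, 1}. 5 * (l + p) - 2 \<le> x \<and> x \<le> 5 * (l + p) + 2"
    if "5 * l - 7 \<le> x" "x \<le> 5 * l + 7" for l x :: int
    using that by (simp; presburger)
  show thesis
  proof -
    have "5 * l - 7 \<le> x" "x \<le> 5 * l + 7" "5 * m - 7 \<le> y" "y \<le> 5 * m + 7"
      using assms by (auto simp: i b window_def)
    then obtain p q where "p \<in> {-1, 0, 1}" "5 * (l + p) - 2 \<le> x" "x \<le> 5 * (l + p) + 2"
        "q \<in> {-1, 0, 1}" "5 * (m + q) - 2 \<le> y" "y \<le> 5 * (m + q) + 2"
      using *[of l x] *[of m y] by blast
    then show thesis by (intro that) (simp_all add: i b block_sites_eq)
  qed
qed

lemma block_of_window:
  assumes "p \<in> {-1, 0, 1}" "q \<in> {-1, 0, 1}"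
  shows "block_sites (b + (p, q)) \<subseteq> window b"
proof -
  have "-1 \<le> p" "p \<le> 1" "-1 \<le> q" "q \<le> 1" using assms by auto
  then have "{5 * (l + p) - 2..5 * (l + p) + 2} \<subseteq> {5 * l - 7..5 * l + 7}"
    "{5 * (m + q) - 2..5 * (m + q) + 2} \<subseteq> {5 * m - 7..5 * m + 7}" for l m
    unfolding atLeastatMost_subset_iff by simp_all
  then show ?thesis by (cases b) (simp add: block_sites_eq window_def Sigma_mono)
qed

text \<open>
  By rigidity, the ground states restrict to a perfect code on every window; conversely the perfect codes
  are ground states. Since they are invariant under block translations, the block in which a
  pattern occurs does not matter.
\<close>

lemma Qp_iff:
  assumes lam: "0 < lam" "lam < 1"
  shows "Q \<in> Qp lam \<longleftrightarrow> (\<exists>s\<in>{2, -2}. \<exists>c. Q = restrict (perfect_code s c) B0)"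
proof
  assume "Q \<in> Qp lam"
  then obtain \<eta> b where Q: "Q = block_pattern \<eta> b" and gs: "periodic_ground_state lam \<eta>"
    unfolding Qp_def mem_Collect_eq by (elim exE conjE)
  have "cover \<eta> i = 1" for i using gs periodic_ground_state_iff[OF lam] by blast
  then have ex: "exact_on \<eta> R" for R by (simp add: exact_on_def X0_iff_cover)
  obtain s c where s: "s \<in> {2, -2}" and agree: "agree_on \<eta> (perfect_code s c) (window b)"
    using exact_window_perfect_code[where \<omega> = \<eta> and r = 7, OF ex, of "5 * fst b" "5 * snd b"]
    unfolding window_def by auto
  have "\<eta> (i + block_shift b) = perfect_code s c i" if "i \<in> B0" for i
  proof -
    have "i + block_shift b \<in> window b"
      using that by (auto simp: B0_def block_shift_def window_def)
    then show ?thesis using agree by (simp add: agree_on_def perfect_code_block_shift)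
  qed
  then have "Q = restrict (perfect_code s c) B0" by (simp add: Q block_pattern_eq_iff)
  then show "\<exists>s\<in>{2, -2}. \<exists>c. Q = restrict (perfect_code s c) B0" using s by blast
next
  assume "\<exists>s\<in>{2, -2}. \<exists>c. Q = restrict (perfect_code s c) B0"
  then obtain s c where s: "s \<in> {2, -2}" and Q: "Q = restrict (perfect_code s c) B0" by blast
  have "periodic_ground_state lam (perfect_code s c)"
    unfolding periodic_ground_state_iff[OF lam] using s cover_perfect_code perfect_code_periodic by blast
  moreover have "Q = block_pattern (perfect_code s c) (0, 0)"
    by (simp add: Q block_pattern_def block_shift_def flip: zero_prod_def)
  ultimately show "Q \<in> Qp lam" unfolding Qp_def by blast
qed

lemma correct_iff:
  assumes lam: "0 < lam" "lam < 1"
  shows "b \<notin> incorrect_blocks lam \<omega> \<longleftrightarrow>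
    (\<exists>s\<in>{2, -2}. \<exists>c. agree_on \<omega> (perfect_code s c) (window b))"
proof -
  have "Q_correct (restrict (perfect_code s c) B0) \<omega> b \<longleftrightarrow> agree_on \<omega> (perfect_code s c) (window b)" for s c
  proof
    assume Q: "Q_correct (restrict (perfect_code s c) B0) \<omega> b"
    show "agree_on \<omega> (perfect_code s c) (window b)"
      unfolding agree_on_def
    proof
      fix i assume "i \<in> window b"
      then obtain p q where pq: "p \<in> {-1, 0, 1}" "q \<in> {-1, 0, 1}" "i \<in> block_sites (b + (p, q))"
        by (rule site_in_block_of_window)
      from pq(3) obtain j where j: "i = j + block_shift (b + (p, q))" "j \<in> B0"
        unfolding block_sites_def by (elim imageE)
      have "block_pattern \<omega> (b + (p, q)) = restrict (perfect_code s c) B0"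
        using Q pq unfolding Q_correct_def by blast
      then show "\<omega> i = perfect_code s c i"
        using j by (simp add: block_pattern_eq_iff perfect_code_block_shift)
    qed
  next
    assume agree: "agree_on \<omega> (perfect_code s c) (window b)"
    have "\<omega> (j + block_shift (b + (p, q))) = perfect_code s c j"
      if "p \<in> {-1, 0, 1}" "q \<in> {-1, 0, 1}" "j \<in> B0" for p q j
    proof -
      have "j + block_shift (b + (p, q)) \<in> window b"
        by (rule subsetD[OF block_of_window[OF that(1,2)]]) (simp add: mem_block_sites_iff that(3))
      then show ?thesis using agree by (simp add: agree_on_def perfect_code_block_shift)
    qed
    then show "Q_correct (restrict (perfect_code s c) B0) \<omega> b"
      unfolding Q_correct_def block_pattern_eq_iff by blast
  qed
  moreover have "(\<exists>Q\<in>Qp lam. Q_correct Q \<omega> b) \<longleftrightarrow>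
      (\<exists>s\<in>{2, -2}. \<exists>c. Q_correct (restrict (perfect_code s c) B0) \<omega> b)"
    unfolding Bex_def Qp_iff[OF lam] by metis
  ultimately show ?thesis
    by (simp add: incorrect_blocks_def)
qed

text \<open>
  The window contains the neighbours of all sites of its central block, so the covers in this block are
  those of a perfect code.
\<close>

lemma correct_block_cover:
  assumes lam: "0 < lam" "lam < 1" and b: "b \<notin> incorrect_blocks lam \<omega>" and i: "i \<in> block_sites b"
  shows "cover \<omega> i = 1"
proof -
  obtain s c where s: "s \<in> {2, -2}" and agree: "agree_on \<omega> (perfect_code s c) (window b)"
    using b correct_iff[OF lam] by blast
  obtain l m x y where [simp]: "b = (l, m)" "i = (x, y)" by (cases b, cases i)
  have "\<omega> (u, v) = perfect_code s c (u, v)" if "\<bar>u - x\<bar> \<le> 1" "\<bar>v - y\<bar> \<le> 1" for u v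
  proof -
    have "(u, v) \<in> window b" using i that by (auto simp: window_def block_sites_eq)
    then show ?thesis using agree by (simp add: agree_on_def)
  qed
  then have "cover \<omega> i = cover (perfect_code s c) i" by (simp add: cover_eq)
  then show ?thesis using cover_perfect_code[OF s] by simp
qed

lemma incorrect_block_defect:
  assumes lam: "0 < lam" "lam < 1" and \<omega>: "\<omega> \<in> X0" and b: "b \<in> incorrect_blocks lam \<omega>"
  obtains i where "i \<in> window b" "cover \<omega> i \<noteq> 1"
proof -
  have "\<not> exact_on \<omega> (window b)"
    using exact_window_perfect_code[of \<omega> "5 * fst b" 7 "5 * snd b"] b correct_iff[OF lam, of b \<omega>]
    unfolding window_def by linarith
  then show thesis using \<omega> that unfolding exact_on_def by blast
qed

section \<open>The particle flux between blocks\<close>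

definition unit_steps :: "site set" where
  "unit_steps = {(1, 0), (-1, 0), (0, 1), (0, -1)}"

text \<open>
  The side of a block that is crossed when entering it in direction \<open>d\<close>.
\<close>

definition entry_line :: "site \<Rightarrow> site set" where
  "entry_line d = {j \<in> B0. j - d \<notin> B0}"

definition line_count :: "config \<Rightarrow> site \<Rightarrow> block \<Rightarrow> nat" where
  "line_count \<omega> d b = (\<Sum>j\<in>entry_line d. of_bool (\<omega> (j + block_shift b)))"

lemma finite_B0: "finite B0" by (simp add: B0_def)

lemma entry_line_eq:
  "entry_line (1, 0) = {-2} \<times> {-2..2}" "entry_line (-1, 0) = {2} \<times> {-2..2}"
  "entry_line (0, 1) = {-2..2} \<times> {-2}" "entry_line (0, -1) = {-2..2} \<times> {2}"
  by (auto simp: entry_line_def B0_def)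

text \<open>
  Here \<open>s\<close> is a unit modulo 5, so the terms \<open>t + s * y\<close> run through all residues. The case \<open>s = 1\<close> serves
  the rows of a perfect code, and \<open>s = 2\<close> and \<open>s = -2\<close> serve its columns.
\<close>

lemma sum_dvd_five_consecutive:
  assumes "s \<in> {1, 2, -2}"
  shows "(\<Sum>y\<in>{-2..2 :: int}. of_bool (5 dvd (t + s * y)) :: nat) = 1"
proof -
  have I: "{-2..2 :: int} = {-2, -1, 0, 1, 2}" by auto
  have "t mod 5 = 0 \<or> t mod 5 = 1 \<or> t mod 5 = 2 \<or> t mod 5 = 3 \<or> t mod 5 = 4" by presburger
  then obtain q r where t: "t = 5 * q + r" and r: "r \<in> {0, 1, 2, 3, 4}"
    by (metis insertCI mult_div_mod_eq)
  have "5 dvd (t + s * y) \<longleftrightarrow> 5 dvd (r + s * y)" for y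
    unfolding t add.assoc by (simp add: dvd_add_right_iff del: dvd_add_triv_left_iff)
  then show ?thesis using r assms unfolding I by (elim insertE emptyE) simp_all
qed

lemma perfect_code_column:
  assumes "s \<in> {2, -2}"
  shows "(\<Sum>y\<in>{-2..2}. of_bool (perfect_code s c (x, y)) :: nat) = 1"
  using sum_dvd_five_consecutive[of s "x - c"] assms
  by (simp add: perfect_code_def algebra_simps)

lemma perfect_code_row:
  "(\<Sum>x\<in>{-2..2}. of_bool (perfect_code s c (x, y)) :: nat) = 1"
  using sum_dvd_five_consecutive[of 1 "s * y - c"]
  by (simp add: perfect_code_def algebra_simps)

lemma
  assumes lam: "0 < lam" "lam < 1" and Q: "block_pattern \<omega> b \<in> Qp lam"
  shows line_count_ground: "d \<in> unit_steps \<Longrightarrow> line_count \<omega> d b = 1"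
    and block_count_ground: "(\<Sum>i\<in>block_sites b. of_bool (\<omega> i) :: nat) = 5"
proof -
  obtain s c where s: "s \<in> {2, -2}" and "block_pattern \<omega> b = restrict (perfect_code s c) B0"
    using Q Qp_iff[OF lam] by metis
  then have eq: "\<omega> (j + block_shift b) = perfect_code s c j" if "j \<in> B0" for j
    using that by (simp add: block_pattern_eq_iff)
  note column = perfect_code_column[OF s, of c]
  show "line_count \<omega> d b = 1" if d: "d \<in> unit_steps"
  proof -
    have "line_count \<omega> d b = (\<Sum>j\<in>entry_line d. of_bool (perfect_code s c j))"
      unfolding line_count_def by (rule sum.cong) (auto simp: eq entry_line_def)
    also have "\<dots> = 1"
      using d unfolding unit_steps_def
      by (elim insertE emptyE)
        (simp_all only: entry_line_eq column perfect_code_row sum.cartesian_product' sum.insert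
          finite.emptyI empty_iff not_False_eq_True sum.empty add_0_right sum.neutral_const)
    finally show ?thesis .
  qed
  have "(\<Sum>i\<in>block_sites b. of_bool (\<omega> i) :: nat) = (\<Sum>j\<in>B0. of_bool (\<omega> (j + block_shift b)))"
    unfolding block_sites_def by (subst sum.reindex) (auto simp: inj_on_def)
  also have "\<dots> = (\<Sum>j\<in>B0. of_bool (perfect_code s c j))"
    by (rule sum.cong) (auto simp: eq)
  also have "\<dots> = (\<Sum>x\<in>{-2..2}. \<Sum>y\<in>{-2..2}. of_bool (perfect_code s c (x, y)))"
    unfolding B0_def sum.cartesian_product by (simp only: case_prod_unfold prod.collapse)
  also have "\<dots> = 5" by (simp only: column) simp
  finally show "(\<Sum>i\<in>block_sites b. of_bool (\<omega> i) :: nat) = 5" .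
qed

text \<open>
  The block translated by \<open>d\<close> loses the side through which \<open>d\<close> enters it and gains the corresponding
  side of the next block.
\<close>

lemma block_flux:
  assumes d: "d \<in> unit_steps"
  shows "(\<Sum>i\<in>block_sites b. of_bool (\<omega> (i + d))) + line_count \<omega> d b =
    (\<Sum>i\<in>block_sites b. of_bool (\<omega> i)) + line_count \<omega> d (b + d)"
proof -
  define g :: "site \<Rightarrow> nat" where "g j = of_bool (\<omega> (j + block_shift b))" for j
  have sites: "(\<Sum>i\<in>block_sites b. f i) = (\<Sum>j\<in>B0. f (j + block_shift b))" for f :: "site \<Rightarrow> nat"
    unfolding block_sites_def by (subst sum.reindex) (auto simp: inj_on_def)
  have shift: "(\<Sum>j\<in>A. g (j + e)) = sum g ((\<lambda>j. j + e) ` A)" for A e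
    by (subst sum.reindex) (auto simp: inj_on_def)
  define B1 where "B1 = (\<lambda>j. j + d) ` B0"
  define L1 where "L1 = (\<lambda>j. j + block_shift d) ` entry_line d"
  have B1: "j \<in> B1 \<longleftrightarrow> j - d \<in> B0" for j
    unfolding B1_def by (auto intro: image_eqI[of _ _ "j - d"])
  have L1: "j \<in> L1 \<longleftrightarrow> j - block_shift d \<in> entry_line d" for j
    unfolding L1_def by (auto intro: image_eqI[of _ _ "j - block_shift d"])
  have fin: "finite B0" "finite B1" "finite L1" "finite (entry_line d)"
    by (simp_all add: finite_B0 B1_def L1_def entry_line_def)
  have disj: "B1 \<inter> entry_line d = {}" by (auto simp: B1 entry_line_def)
  have "j \<in> B1 \<union> entry_line d \<longleftrightarrow> j \<in> B0 \<union> L1" "\<not> (j \<in> B0 \<and> j \<in> L1)" for j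
    using d unfolding unit_steps_def
    by (cases j; elim insertE emptyE; auto simp: B1 L1 entry_line_eq B0_def block_shift_def)+
  then have "B1 \<union> entry_line d = B0 \<union> L1" "B0 \<inter> L1 = {}" by blast+
  then have "sum g B1 + sum g (entry_line d) = sum g B0 + sum g L1"
    using fin disj sum.union_disjoint[of B1 "entry_line d" g] sum.union_disjoint[of B0 L1 g] by simp
  moreover have "(\<Sum>i\<in>block_sites b. of_bool (\<omega> (i + d))) = sum g B1"
    unfolding B1_def shift[symmetric] sites g_def by (simp add: ac_simps)
  moreover have "line_count \<omega> d (b + d) = sum g L1"
    unfolding L1_def shift[symmetric] line_count_def g_def
    by (simp add: block_shift_def prod_eq_iff algebra_simps)
  moreover have "line_count \<omega> d b = sum g (entry_line d)" by (simp add: line_count_def g_def)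
  moreover have "(\<Sum>i\<in>block_sites b. of_bool (\<omega> i)) = sum g B0" by (simp add: sites g_def)
  ultimately show ?thesis by simp
qed

section \<open>Contours\<close>

lemma contour_absorbs:
  assumes \<Gamma>: "contour lam \<omega> \<Gamma>" and b: "b \<in> \<Gamma>" and c: "c \<in> incorrect_blocks lam \<omega>" and adj: "block_adj b c"
  shows "c \<in> \<Gamma>"
proof -
  define R where "R C = {(x, y). x \<in> C \<and> y \<in> C \<and> block_adj x y}" for C
  have conn: "connected_blocks C \<longleftrightarrow> (\<forall>x\<in>C. \<forall>y\<in>C. (x, y) \<in> (R C)\<^sup>*)" for C
    unfolding connected_blocks_def R_def ..
  let ?\<Delta> = "insert c \<Gamma>"
  have "(R \<Gamma>)\<^sup>* \<subseteq> (R ?\<Delta>)\<^sup>*" by (rule rtrancl_mono) (auto simp: R_def)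
  then have old: "(x, y) \<in> (R ?\<Delta>)\<^sup>*" if "x \<in> \<Gamma>" "y \<in> \<Gamma>" for x y
    using \<Gamma> that unfolding contour_def conn by blast
  have "(b, c) \<in> R ?\<Delta>" "(c, b) \<in> R ?\<Delta>"
    using b adj by (auto simp: R_def block_adj_def)
  then have "(x, b) \<in> (R ?\<Delta>)\<^sup>*" "(b, x) \<in> (R ?\<Delta>)\<^sup>*" if "x \<in> ?\<Delta>" for x
    using that old b by blast+
  then have "connected_blocks ?\<Delta>" unfolding conn by (meson rtrancl_trans)
  then have "?\<Delta> = \<Gamma>" using \<Gamma> c unfolding contour_def by blast
  then show ?thesis by blast
qed

lemma correct_neighbour_pattern:
  assumes "b \<notin> incorrect_blocks lam \<omega>" "p \<in> {-1, 0, 1}" "q \<in> {-1, 0, 1}"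
  shows "block_pattern \<omega> (b + (p, q)) \<in> Qp lam"
proof -
  obtain Q where "Q \<in> Qp lam" "Q_correct Q \<omega> b" using assms(1) by (auto simp: incorrect_blocks_def)
  moreover from this have "block_pattern \<omega> (b + (p, q)) = Q"
    using assms(2,3) unfolding Q_correct_def by blast
  ultimately show ?thesis by simp
qed

text \<open>
  The two sums run over \<open>\<Gamma> + d\<close> and \<open>\<Gamma>\<close>. A block in only one of these sets is correct or has the correct
  neighbour \<open>b - d\<close>; either way it carries a ground state pattern, and its line contains exactly
  one particle. Since \<open>\<Gamma> + d\<close> and \<open>\<Gamma>\<close> have the same size, it suffices to compare the sums of the line counts minus
  1, where only the common blocks contribute.
\<close>

lemma contour_flux_zero:
  assumes lam: "0 < lam" "lam < 1" and \<Gamma>: "contour lam \<omega> \<Gamma>" "finite \<Gamma>" and d: "d \<in> unit_steps"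
  shows "(\<Sum>b\<in>\<Gamma>. line_count \<omega> d (b + d)) = (\<Sum>b\<in>\<Gamma>. line_count \<omega> d b)"
proof -
  define g where "g b = int (line_count \<omega> d b) - 1" for b
  define \<Delta> where "\<Delta> = (\<lambda>b. b + d) ` \<Gamma>"
  have inc: "\<Gamma> \<subseteq> incorrect_blocks lam \<omega>" using \<Gamma>(1) by (simp add: contour_def)
  obtain p q where pq: "d = (p, q)" "p \<in> {-1, 0, 1}" "q \<in> {-1, 0, 1}" "(p, q) \<noteq> (0, 0)"
    using d by (auto simp: unit_steps_def)
  have adj: "block_adj b (b - d)" "block_adj b (b + d)" for b
    using pq by (auto simp: block_adj_def prod_eq_iff)
  have out: "c \<notin> incorrect_blocks lam \<omega>" if "b \<in> \<Gamma>" "block_adj b c" "c \<notin> \<Gamma>" for b c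
    using contour_absorbs[OF \<Gamma>(1)] that by blast
  have enter: "g b = 0" if "b \<in> \<Gamma>" "b \<notin> \<Delta>" for b
  proof -
    have "b - d \<notin> \<Gamma>" using that(2) unfolding \<Delta>_def by (auto intro: image_eqI[of _ _ "b - d"])
    then have "b - d \<notin> incorrect_blocks lam \<omega>" using out adj that(1) by blast
    then have "block_pattern \<omega> (b - d + d) \<in> Qp lam"
      using correct_neighbour_pattern[of "b - d" lam \<omega> p q] pq by simp
    then show ?thesis using line_count_ground[OF lam _ d] by (simp add: g_def)
  qed
  have exit: "g b = 0" if "b \<in> \<Delta>" "b \<notin> \<Gamma>" for b
  proof -
    from that(1) obtain b' where "b = b' + d" "b' \<in> \<Gamma>" unfolding \<Delta>_def by (elim imageE)
    then have "b \<notin> incorrect_blocks lam \<omega>" using out adj that(2) by blast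
    then have "block_pattern \<omega> (b + (0, 0)) \<in> Qp lam" by (rule correct_neighbour_pattern) auto
    then have "block_pattern \<omega> b \<in> Qp lam" by (simp flip: zero_prod_def)
    then show ?thesis using line_count_ground[OF lam _ d] by (simp add: g_def)
  qed
  have "(\<Sum>b\<in>\<Gamma>. g (b + d)) = sum g \<Delta>"
    unfolding \<Delta>_def by (subst sum.reindex) (auto simp: inj_on_def)
  also have "\<dots> = sum g (\<Gamma> \<inter> \<Delta>)"
    by (rule sum.mono_neutral_right) (use \<Gamma>(2) exit in \<open>auto simp: \<Delta>_def\<close>)
  also have "\<dots> = sum g \<Gamma>"
    by (rule sum.mono_neutral_left) (use \<Gamma>(2) enter in auto)
  finally have "int (\<Sum>b\<in>\<Gamma>. line_count \<omega> d (b + d)) = int (\<Sum>b\<in>\<Gamma>. line_count \<omega> d b)"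
    by (simp add: g_def sum_subtractf)
  then show ?thesis by (simp only: of_nat_eq_iff)
qed

lemma occ_blocks_eq_sum:
  assumes "finite \<Gamma>"
  shows "occ_blocks \<omega> \<Gamma> = (\<Sum>b\<in>\<Gamma>. \<Sum>i\<in>block_sites b. of_bool (\<omega> i))"
proof -
  have fin: "finite (block_sites b)" for b by (simp add: block_sites_def finite_B0)
  have disj: "block_sites b \<inter> block_sites c = {}" if "b \<noteq> c" for b c
    using that by (cases b; cases c) (auto simp: block_sites_eq)
  have "occ_blocks \<omega> \<Gamma> = (\<Sum>i\<in>(\<Union>b\<in>\<Gamma>. block_sites b). of_bool (\<omega> i))"
    unfolding occ_blocks_def by (rule occ_eq_sum) (use assms fin in blast)
  also have "\<dots> = (\<Sum>b\<in>\<Gamma>. \<Sum>i\<in>block_sites b. of_bool (\<omega> i))"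
    by (rule sum.UNION_disjoint) (use assms fin disj in blast)+
  finally show ?thesis .
qed

lemma occ_contour_eq_cover_sum:
  assumes lam: "0 < lam" "lam < 1" and \<Gamma>: "contour lam \<omega> \<Gamma>" "finite \<Gamma>"
  shows "5 * occ_blocks \<omega> \<Gamma> = (\<Sum>b\<in>\<Gamma>. \<Sum>i\<in>block_sites b. cover \<omega> i)"
proof -
  have shifted: "(\<Sum>b\<in>\<Gamma>. \<Sum>i\<in>block_sites b. of_bool (\<omega> (i + d))) = occ_blocks \<omega> \<Gamma>"
    if "d \<in> unit_steps" for d
  proof -
    have "(\<Sum>b\<in>\<Gamma>. (\<Sum>i\<in>block_sites b. of_bool (\<omega> (i + d))) + line_count \<omega> d b) =
        (\<Sum>b\<in>\<Gamma>. (\<Sum>i\<in>block_sites b. of_bool (\<omega> i)) + line_count \<omega> d (b + d))"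
      by (intro sum.cong refl block_flux that)
    then show ?thesis
      using contour_flux_zero[OF lam \<Gamma> that] by (simp only: sum.distrib occ_blocks_eq_sum[OF \<Gamma>(2)])
  qed
  have cover: "cover \<omega> i = of_bool (\<omega> i) + of_bool (\<omega> (i + (1, 0))) + of_bool (\<omega> (i + (-1, 0)))
      + of_bool (\<omega> (i + (0, 1))) + of_bool (\<omega> (i + (0, -1)))" for i
    by (cases i) (simp add: cover_eq)
  show ?thesis
    unfolding cover sum.distrib
    by (subst (1 2 3 4) shifted) (simp_all add: unit_steps_def flip: occ_blocks_eq_sum[OF \<Gamma>(2)])
qed

text \<open>
  An incorrect block has a defect in its window. A correct block contains no defect, so the block of
  the defect is incorrect too. It is equal or adjacent to the given one, so it belongs to the same contour.
  Each defect block is reached in this way from at most nine blocks.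
\<close>

lemma card_le_nine_defect_blocks:
  assumes lam: "0 < lam" "lam < 1" and \<omega>: "\<omega> \<in> X0" and \<Gamma>: "contour lam \<omega> \<Gamma>" "finite \<Gamma>"
  shows "card \<Gamma> \<le> 9 * card {b \<in> \<Gamma>. \<exists>i\<in>block_sites b. cover \<omega> i \<noteq> 1}"
proof -
  define D where "D = {b \<in> \<Gamma>. \<exists>i\<in>block_sites b. cover \<omega> i \<noteq> 1}"
  define N :: "block set" where "N = {-1, 0, 1} \<times> {-1, 0, 1}"
  have "b \<in> (\<lambda>(c, e). c - e) ` (D \<times> N)" if b: "b \<in> \<Gamma>" for b
  proof -
    have "b \<in> incorrect_blocks lam \<omega>" using b \<Gamma>(1) by (auto simp: contour_def)
    then obtain i where i: "i \<in> window b" "cover \<omega> i \<noteq> 1"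
      by (rule incorrect_block_defect[OF lam \<omega>])
    from i(1) obtain p q where pq: "p \<in> {-1, 0, 1}" "q \<in> {-1, 0, 1}" "i \<in> block_sites (b + (p, q))"
      by (rule site_in_block_of_window)
    have "b + (p, q) \<in> incorrect_blocks lam \<omega>"
      using correct_block_cover[OF lam _ pq(3)] i(2) by blast
    moreover have "b + (p, q) = b \<or> block_adj b (b + (p, q))"
      using pq(1,2) by (auto simp: block_adj_def prod_eq_iff)
    ultimately have "b + (p, q) \<in> \<Gamma>" using contour_absorbs[OF \<Gamma>(1) b] b by metis
    then have "(b + (p, q), (p, q)) \<in> D \<times> N" using i(2) pq by (auto simp: D_def N_def)
    then show ?thesis by (rule rev_image_eqI) simp
  qed
  moreover have fin: "finite (D \<times> N)" using \<Gamma>(2) by (simp add: D_def N_def)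
  ultimately have "card \<Gamma> \<le> card ((\<lambda>(c, e). c - e) ` (D \<times> N))"
    by (intro card_mono) auto
  also have "\<dots> \<le> card (D \<times> N)" by (rule card_image_le[OF fin])
  also have "\<dots> = 9 * card D" by (simp add: card_cartesian_product N_def)
  finally show ?thesis by (simp add: D_def)
qed

text \<open>
  Each of the 25 sites of a block has cover at least 1, and a defect block has total cover at least
  26, while a ground state has exactly 5 particles in every block.
\<close>

theorem theorem6p4:
  fixes lam :: real and \<omega> \<eta> :: config and \<Gamma> :: "block set"
  assumes "0 < lam" and "lam < 1"
    and "\<omega> \<in> X0"
    and "periodic_ground_state lam \<eta>"
    and "contour lam \<omega> \<Gamma>" and "finite \<Gamma>"
  shows "real (occ_blocks \<omega> \<Gamma>) - real (occ_blocks \<eta> \<Gamma>) \<ge> max 1 (1 / 270 * real (card \<Gamma>))"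
proof -
  note lam = assms(1,2)
  define D where "D = {b \<in> \<Gamma>. \<exists>i\<in>block_sites b. cover \<omega> i \<noteq> 1}"
  have pos: "1 \<le> cover \<omega> i" for i using assms(3) unfolding X0_iff_cover by blast
  have fin: "finite (block_sites b)" for b by (simp add: block_sites_def finite_B0)
  have card25: "card (block_sites b) = 25" for b
    by (cases b) (simp add: block_sites_eq card_cartesian_product)
  have block: "25 + of_bool (b \<in> D) \<le> (\<Sum>i\<in>block_sites b. cover \<omega> i)" if "b \<in> \<Gamma>" for b
  proof -
    have ge: "25 \<le> (\<Sum>i\<in>block_sites b. cover \<omega> i)"
      using sum_mono[of "block_sites b" "\<lambda>_. 1" "cover \<omega>"] pos card25 by simp
    have "25 < (\<Sum>i\<in>block_sites b. cover \<omega> i)" if bD: "b \<in> D"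
    proof -
      obtain i where "i \<in> block_sites b" "cover \<omega> i \<noteq> 1" using bD unfolding D_def by blast
      then have "(\<Sum>i\<in>block_sites b. 1) < (\<Sum>i\<in>block_sites b. cover \<omega> i)"
        using pos[of i] by (intro sum_strict_mono_ex1 fin ballI pos bexI[of _ i]) simp_all
      then show ?thesis by (simp add: card25)
    qed
    with ge show ?thesis by (cases "b \<in> D") auto
  qed
  have "25 * card \<Gamma> + card D = (\<Sum>b\<in>\<Gamma>. 25 + of_bool (b \<in> D))"
    using assms(6) by (simp add: sum.distrib D_def Int_def)
  also have "\<dots> \<le> (\<Sum>b\<in>\<Gamma>. \<Sum>i\<in>block_sites b. cover \<omega> i)" by (rule sum_mono[OF block])
  also have "\<dots> = 5 * occ_blocks \<omega> \<Gamma>" by (rule occ_contour_eq_cover_sum[OF lam assms(5,6), symmetric])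
  finally have \<omega>: "25 * card \<Gamma> + card D \<le> 5 * occ_blocks \<omega> \<Gamma>" .
  have "block_pattern \<eta> b \<in> Qp lam" for b using assms(4) unfolding Qp_def by blast
  then have \<eta>: "occ_blocks \<eta> \<Gamma> = 5 * card \<Gamma>"
    using block_count_ground[OF lam] by (simp add: occ_blocks_eq_sum[OF assms(6)] del: sum_of_bool_eq)
  have nine: "card \<Gamma> \<le> 9 * card D"
    unfolding D_def by (rule card_le_nine_defect_blocks[OF lam assms(3,5,6)])
  have "0 < card \<Gamma>" using assms(5,6) by (auto simp: contour_def card_gt_0_iff)
  with nine \<omega> \<eta> have "occ_blocks \<eta> \<Gamma> + 1 \<le> occ_blocks \<omega> \<Gamma>"
    "card \<Gamma> + 45 * occ_blocks \<eta> \<Gamma> \<le> 45 * occ_blocks \<omega> \<Gamma>" by linarith+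
  then have "real (occ_blocks \<eta> \<Gamma> + 1) \<le> real (occ_blocks \<omega> \<Gamma>)"
    "real (card \<Gamma> + 45 * occ_blocks \<eta> \<Gamma>) \<le> real (45 * occ_blocks \<omega> \<Gamma>)"
    by (simp_all only: of_nat_le_iff)
  then show ?thesis by simp
qed

end
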